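(* Let $q$ be a prime power, let $k\ge 2$ be an integer, write $q_m=\frac{q^m-1}{q-1}$, and let $C$ be a non-degenerate $[n,k]_q$ MWS code with spread $\Delta(C)$. Then $$n=\frac{q}{2}\,q_k+\frac{\Delta(C)}{q_{k-1}}.$$
   Context: An $[n,k]_q$ linear code is a $k$-dimensional subspace of $\mathbb{F}_q^n$. It is non-degenerate if no coordinate is identically zero on the code. For a linear code $C$, $S(C)$ denotes the set of Hamming weights of nonzero codewords of $C$. A $k$-dimensional linear code over $\mathbb{F}_q$ has at most $q_k=\frac{q^k-1}{q-1}$ distinct nonzero weights; it is called a maximum weight spectrum (MWS) code if $|S(C)|=q_k$. For an $[n,k]_q$ MWS code $C$ write $S(C)=\{n-s_0,\ldots,n-s_{q_k-1}\}$ with $s_0<s_1<\cdots<s_{q_k-1}$; the spread of $C$ is $\Delta(C)=\sum_{i=0}^{q_k-1}(s_i-i)$. *)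

theory Defs
  imports "HOL-Analysis.Cartesian_Space"
begin

text \<open>
  The alphabet is a finite field type \<open>'a\<close> with \<open>q = CARD('a)\<close>, the ambient space is
  \<open>'a ^ 'n\<close> with \<open>n = CARD('n)\<close>.
\<close>

definition linear_code :: "nat \<Rightarrow> ('a::{field,finite} ^ 'n) set \<Rightarrow> bool" where
  "linear_code k C \<longleftrightarrow> vec.subspace C \<and> vec.dim C = k"

definition non_degenerate :: "('a::zero ^ 'n) set \<Rightarrow> bool" where
  "non_degenerate C \<longleftrightarrow> (\<forall>i. \<exists>c\<in>C. c $ i \<noteq> 0)"

definition hamming_weight :: "'a::zero ^ 'n \<Rightarrow> nat" where
  "hamming_weight c = card {i. c $ i \<noteq> 0}"

definition weight_spectrum :: "('a::zero ^ 'n) set \<Rightarrow> nat set" where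
  "weight_spectrum C = hamming_weight ` (C - {0})"

text \<open>The division is exact: \<open>q - 1\<close> divides \<open>q ^ m - 1\<close>.\<close>

definition q_number :: "nat \<Rightarrow> nat \<Rightarrow> nat" where
  "q_number q m = (q ^ m - 1) div (q - 1)"

definition mws_code :: "nat \<Rightarrow> ('a::{field,finite} ^ 'n) set \<Rightarrow> bool" where
  "mws_code k C \<longleftrightarrow> linear_code k C \<and> card (weight_spectrum C) = q_number CARD('a) k"

text \<open>
  The increasing list of the numbers \<open>s = n - w\<close>, for \<open>w\<close> a nonzero weight. Weights are at
  most \<open>n\<close>, so the subtraction on \<open>nat\<close> does not truncate.
\<close>

definition coweights :: "('a::zero ^ 'n) set \<Rightarrow> nat list" where
  "coweights C = sorted_list_of_set ((\<lambda>w. CARD('n) - w) ` weight_spectrum C)"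

text \<open>For an MWS code of dimension \<open>k\<close>, \<open>card (weight_spectrum C)\<close> is \<open>q_number q k\<close>.\<close>

definition spread :: "('a::zero ^ 'n) set \<Rightarrow> int" where
  "spread C = (\<Sum>i<card (weight_spectrum C). int (coweights C ! i) - int i)"

end

theory Submission
  imports Defs
begin

text \<open>
  The zero entries of all codewords are counted in two ways. No coordinate vanishes identically
  on \<open>C\<close>, so each coordinate is a nonzero linear functional and vanishes on \<open>q ^ (k - 1)\<close>
  codewords (\<open>card_coordinate_kernel\<close>). Without the zero word, which contributes \<open>n\<close> zeros,
  the nonzero codewords have \<open>n * (q ^ (k - 1) - 1)\<close> zeros together
  (\<open>sum_zeros_nonzero_codewords\<close>).

  On the other hand, the nonzero multiples of a codeword have its weight, so every weight is
  attained at least \<open>q - 1\<close> times. An MWS code has \<open>(q ^ k - 1) / (q - 1)\<close> weights for its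
  \<open>q ^ k - 1\<close> nonzero codewords, which leaves room for exactly \<open>q - 1\<close> codewords per weight
  (\<open>mws_card_weight_class\<close>). The same number of zeros is therefore \<open>q - 1\<close> times the sum of
  the coweights \<open>s\<^sub>i\<close>, and division by \<open>q - 1\<close> turns the count into
  \<open>(\<Sum>i. s\<^sub>i) = n * q\<^sub>k\<^sub>-\<^sub>1\<close> (\<open>mws_sum_coweights\<close>).

  The spread is this sum minus \<open>q\<^sub>k * (q\<^sub>k - 1) / 2\<close>. Since \<open>q\<^sub>k - 1 = q * q\<^sub>k\<^sub>-\<^sub>1\<close>, both terms
  contain the factor \<open>q\<^sub>k\<^sub>-\<^sub>1\<close>, and dividing by it and solving for \<open>n\<close> gives the formula.
\<close>

section \<open>The numbers \<open>(q ^ m - 1) / (q - 1)\<close>\<close>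

lemma power_Suc_minus_one:
  assumes "q \<ge> (1 :: nat)"
  shows "q ^ Suc m - 1 = q * (q ^ m - 1) + (q - 1)"
proof -
  have "q ^ m \<ge> 1" using assms by simp
  then show ?thesis using assms by (simp add: diff_mult_distrib2)
qed

lemma q_number_mult:
  assumes "q \<ge> 1"
  shows "(q - 1) * q_number q m = q ^ m - 1"
proof -
  have "(q - 1) dvd (q ^ m - 1)"
  proof (induction m)
    case (Suc m)
    then show ?case unfolding power_Suc_minus_one[OF assms] by simp
  qed simp
  then show ?thesis by (simp add: q_number_def)
qed

lemma q_number_Suc:
  assumes "q \<ge> 2"
  shows "q_number q (Suc m) = q * q_number q m + 1"
proof -
  have q: "q \<ge> 1" using assms by simp
  have "(q - 1) * q_number q (Suc m) = q * ((q - 1) * q_number q m) + (q - 1)"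
    unfolding q_number_mult[OF q] by (rule power_Suc_minus_one[OF q])
  also have "\<dots> = (q - 1) * (q * q_number q m + 1)"
    by (simp only: distrib_left mult.left_commute mult_1_right)
  finally have "(q - 1) * q_number q (Suc m) = (q - 1) * (q * q_number q m + 1)" .
  moreover have "0 < q - 1" using assms by simp
  ultimately show ?thesis by (simp only: nat_mult_eq_cancel1)
qed

section \<open>Subspaces over a finite field\<close>

lemma CARD_field_ge_2: "CARD('a::{field,finite}) \<ge> 2"
proof -
  have "card {0, 1 :: 'a} \<le> CARD('a)" by (rule card_mono) auto
  then show ?thesis by simp
qed

text \<open>
  The sum of the subspace \<open>K\<close> and the line through \<open>v\<close> is direct, so its elements correspond to
  pairs of a scalar and an element of \<open>K\<close>. This one count yields both the size of a code
  (adding basis vectors one at a time) and the size of the kernel of a functional.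
\<close>

lemma card_add_line:
  fixes K :: "('a::{field,finite} ^ 'n) set"
  assumes K: "vec.subspace K" and v: "v \<notin> K"
  shows "card {x. \<exists>a. x - a *s v \<in> K} = CARD('a) * card K"
proof -
  have coeff_unique: "a = b" if "a *s v + x = b *s v + y" "x \<in> K" "y \<in> K" for a b x y
  proof (rule ccontr)
    assume "a \<noteq> b"
    have "(a - b) *s v = y - x" using that by (simp add: vector_sub_rdistrib algebra_simps)
    then have "(a - b) *s v \<in> K" using K that by (simp add: vec.subspace_diff)
    then have "inverse (a - b) *s ((a - b) *s v) \<in> K" using K by (rule vec.subspace_scale[rotated])
    then show False using \<open>a \<noteq> b\<close> v by (simp add: vector_smult_assoc)
  qed
  have "inj_on (\<lambda>(a, y). a *s v + y) (UNIV \<times> K)"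
  proof (rule inj_onI, clarify)
    fix a b x y assume "x \<in> K" "y \<in> K" and eq: "a *s v + x = b *s v + y"
    then have "a = b" by (intro coeff_unique)
    with eq show "a = b \<and> x = y" by simp
  qed
  moreover have "(\<lambda>(a, y). a *s v + y) ` (UNIV \<times> K) = {x. \<exists>a. x - a *s v \<in> K}"
  proof (intro set_eqI iffI)
    fix x assume "x \<in> {x. \<exists>a. x - a *s v \<in> K}"
    then obtain a where "x - a *s v \<in> K" by blast
    then show "x \<in> (\<lambda>(a, y). a *s v + y) ` (UNIV \<times> K)"
      by (intro image_eqI[of _ _ "(a, x - a *s v)"]) auto
  next
    fix x assume "x \<in> (\<lambda>(a, y). a *s v + y) ` (UNIV \<times> K)"
    then obtain a y where "y \<in> K" "x = a *s v + y" by auto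
    then have "x - a *s v \<in> K" by simp
    then show "x \<in> {x. \<exists>a. x - a *s v \<in> K}" by blast
  qed
  ultimately show ?thesis
    using card_image card_cartesian_product by metis
qed

lemma card_span_independent:
  fixes B :: "('a::{field,finite} ^ 'n) set"
  assumes "vec.independent B"
  shows "card (vec.span B) = CARD('a) ^ card B"
  using finite[of B] assms
proof (induction B rule: finite_induct)
  case (insert b B)
  then have "vec.independent B" "b \<notin> vec.span B"
    by (auto simp: vec.independent_insert)
  with insert show ?case
    by (simp add: vec.span_insert card_add_line)
qed simp

lemma card_linear_code:
  fixes C :: "('a::{field,finite} ^ 'n) set"
  assumes "linear_code k C"
  shows "card C = CARD('a) ^ k"
proof -
  obtain B where B: "B \<subseteq> C" "vec.independent B" "C \<subseteq> vec.span B" "card B = vec.dim C"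
    using vec.basis_exists by blast
  have "vec.span B = C"
    using assms B by (simp add: linear_code_def vec.span_minimal subset_antisym)
  then show ?thesis
    using assms B card_span_independent[of B] by (simp add: linear_code_def)
qed

text \<open>
  The code is the direct sum of the kernel of the coordinate and the line through any codeword
  on which the coordinate does not vanish.
\<close>

lemma card_coordinate_kernel:
  fixes C :: "('a::{field,finite} ^ 'n) set"
  assumes C: "vec.subspace C" and v: "v \<in> C" "v $ i \<noteq> 0"
  shows "card C = CARD('a) * card {c \<in> C. c $ i = 0}"
proof -
  let ?K = "{c \<in> C. c $ i = 0}"
  have K: "vec.subspace ?K"
    using C by (auto simp: vec.subspace_def)
  have direct_sum: "{x. \<exists>a. x - a *s v \<in> ?K} = C"
  proof (intro set_eqI iffI)
    fix x assume "x \<in> {x. \<exists>a. x - a *s v \<in> ?K}"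
    then obtain a where "x - a *s v \<in> C" by blast
    then have "(x - a *s v) + a *s v \<in> C"
      using C v by (intro vec.subspace_add vec.subspace_scale)
    then show "x \<in> C" by simp
  next
    fix x assume "x \<in> C"
    then have "x - (x $ i / v $ i) *s v \<in> ?K"
      using C v by (simp add: vec.subspace_diff vec.subspace_scale)
    then show "x \<in> {x. \<exists>a. x - a *s v \<in> ?K}" by blast
  qed
  have "v \<notin> ?K" using v by simp
  from card_add_line[OF K this] show ?thesis unfolding direct_sum .
qed

section \<open>Zeros of codewords\<close>

lemma coweight_eq_card_zeros:
  fixes c :: "'a::zero ^ 'n"
  shows "CARD('n) - hamming_weight c = card {i. c $ i = 0}"
proof -
  have "{i. c $ i = 0} = - {i. c $ i \<noteq> 0}" by auto
  then show ?thesis by (simp add: hamming_weight_def Compl_eq_Diff_UNIV card_Diff_subset)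
qed

lemma hamming_weight_le: "hamming_weight (c :: 'a::zero ^ 'n) \<le> CARD('n)"
  by (simp add: hamming_weight_def card_mono)

text \<open>Summing over coordinates first, every coordinate contributes the size of its kernel.\<close>

lemma sum_zeros_nonzero_codewords:
  fixes C :: "('a::{field,finite} ^ 'n) set"
  assumes "linear_code (Suc m) C" and nd: "non_degenerate C"
  shows "(\<Sum>c\<in>C - {0}. CARD('n) - hamming_weight c) = CARD('n) * (CARD('a) ^ m - 1)"
proof -
  have C: "vec.subspace C" using assms(1) by (simp add: linear_code_def)
  have kernel: "card {c \<in> C. c $ i = 0} = CARD('a) ^ m" for i
  proof -
    obtain v where "v \<in> C" "v $ i \<noteq> 0" using nd by (auto simp: non_degenerate_def)
    then have "CARD('a) * card {c \<in> C. c $ i = 0} = CARD('a) * CARD('a) ^ m"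
      using card_coordinate_kernel[OF C] card_linear_code[OF assms(1)] by simp
    then show ?thesis by simp
  qed
  have "(\<Sum>c\<in>C. card {i. c $ i = 0}) = (\<Sum>c\<in>C. \<Sum>i\<in>UNIV. if c $ i = 0 then 1 else 0)"
    by (simp add: sum.If_cases)
  also have "\<dots> = (\<Sum>i\<in>UNIV. \<Sum>c\<in>C. if c $ i = 0 then 1 else 0)"
    by (rule sum.swap)
  also have "\<dots> = CARD('n) * CARD('a) ^ m"
    using kernel by (simp add: sum.If_cases Int_def)
  finally have "(\<Sum>c\<in>C. card {i. c $ i = 0}) = CARD('n) * CARD('a) ^ m" .
  moreover have "0 \<in> C" using C by (rule vec.subspace_0)
  ultimately show ?thesis
    by (simp add: coweight_eq_card_zeros sum_diff1_nat diff_mult_distrib2)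
qed

section \<open>Weight classes of MWS codes\<close>

lemma hamming_weight_scale:
  fixes c :: "'a::field ^ 'n"
  assumes "a \<noteq> 0"
  shows "hamming_weight (a *s c) = hamming_weight c"
  using assms by (simp add: hamming_weight_def)

lemma card_weight_class_ge:
  fixes C :: "('a::{field,finite} ^ 'n) set"
  assumes C: "vec.subspace C" and w: "w \<in> weight_spectrum C"
  shows "CARD('a) - 1 \<le> card {c \<in> C - {0}. hamming_weight c = w}"
proof -
  obtain c where c: "c \<in> C" "c \<noteq> 0" "hamming_weight c = w"
    using w by (auto simp: weight_spectrum_def)
  have "inj_on (\<lambda>a. a *s c) (UNIV - {0})"
    using c by (auto intro!: inj_onI simp: vec.scale_right_imp_eq)
  then have "CARD('a) - 1 = card ((\<lambda>a. a *s c) ` (UNIV - {0}))"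
    by (simp add: card_image)
  also have "\<dots> \<le> card {c \<in> C - {0}. hamming_weight c = w}"
    using C c by (intro card_mono) (auto simp: vec.subspace_scale hamming_weight_scale)
  finally show ?thesis .
qed

text \<open>
  The lower bounds \<open>q - 1\<close> for the classes already add up to the number of nonzero codewords,
  so none of them can be strict.
\<close>

lemma mws_card_weight_class:
  fixes C :: "('a::{field,finite} ^ 'n) set"
  assumes mws: "mws_code k C" and w: "w \<in> weight_spectrum C"
  shows "card {c \<in> C - {0}. hamming_weight c = w} = CARD('a) - 1"
proof -
  let ?W = "weight_spectrum C"
  let ?F = "\<lambda>w. {c \<in> C - {0}. hamming_weight c = w}"
  have code: "linear_code k C" and card_W: "card ?W = q_number CARD('a) k"
    using mws by (auto simp: mws_code_def)
  have C: "vec.subspace C" using code by (simp add: linear_code_def)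
  have W: "finite ?W" by (simp add: weight_spectrum_def)
  have "(\<Sum>w\<in>?W. card (?F w)) = card (C - {0})"
    using sum.group[of "C - {0}" ?W hamming_weight "\<lambda>_. 1 :: nat"] W
    by (simp add: weight_spectrum_def)
  also have "\<dots> = CARD('a) ^ k - 1"
    using vec.subspace_0[OF C] card_linear_code[OF code] by simp
  also have "\<dots> = (\<Sum>w\<in>?W. CARD('a) - 1)"
    using q_number_mult[of "CARD('a)" k] card_W by (simp add: mult.commute)
  finally have "(\<Sum>w\<in>?W. CARD('a) - 1) = (\<Sum>w\<in>?W. card (?F w))" ..
  from sum_mono_inv[OF this card_weight_class_ge[OF C] w W] show ?thesis by simp
qed

text \<open>
  Grouping the nonzero codewords by weight gives every coweight the multiplicity \<open>q - 1\<close> in the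
  count of zeros.
\<close>

lemma mws_sum_coweights:
  fixes C :: "('a::{field,finite} ^ 'n) set"
  assumes mws: "mws_code (Suc m) C" and nd: "non_degenerate C"
  shows "(\<Sum>w\<in>weight_spectrum C. CARD('n) - w) = CARD('n) * q_number CARD('a) m"
proof -
  let ?W = "weight_spectrum C"
  let ?q = "CARD('a)"
  have code: "linear_code (Suc m) C" using mws by (simp add: mws_code_def)
  have q: "?q \<ge> 2" by (rule CARD_field_ge_2)
  have "(?q - 1) * (\<Sum>w\<in>?W. CARD('n) - w)
      = (\<Sum>w\<in>?W. card {c \<in> C - {0}. hamming_weight c = w} * (CARD('n) - w))"
    unfolding sum_distrib_left using mws_card_weight_class[OF mws] by (intro sum.cong) auto
  also have "\<dots> = (\<Sum>w\<in>?W. \<Sum>c | c \<in> C - {0} \<and> hamming_weight c = w. CARD('n) - hamming_weight c)"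
    by (intro sum.cong) auto
  also have "\<dots> = (\<Sum>c\<in>C - {0}. CARD('n) - hamming_weight c)"
    by (rule sum.group) (auto simp: weight_spectrum_def)
  also have "\<dots> = (?q - 1) * (CARD('n) * q_number ?q m)"
    using sum_zeros_nonzero_codewords[OF code nd] q_number_mult[of ?q m] q
    by (simp add: mult.left_commute)
  finally show ?thesis using q by simp
qed

section \<open>The spread and the length\<close>

text \<open>
  Sorting does not affect the sum of the coweights, and the subtracted indices are an arithmetic
  progression. Both sides are doubled to avoid halving the product of two consecutive integers.
\<close>

lemma twice_spread:
  fixes C :: "('a::{field,finite} ^ 'n) set"
  shows "2 * spread C = 2 * int (\<Sum>w\<in>weight_spectrum C. CARD('n) - w)
           - int (card (weight_spectrum C)) * (int (card (weight_spectrum C)) - 1)"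
proof -
  let ?W = "weight_spectrum C"
  let ?S = "(\<lambda>w. CARD('n) - w) ` ?W"
  have W: "finite ?W" by (simp add: weight_spectrum_def)
  have "w \<le> CARD('n)" if "w \<in> ?W" for w
    using that hamming_weight_le by (auto simp: weight_spectrum_def)
  then have inj: "inj_on (\<lambda>w. CARD('n) - w) ?W"
    by (metis (no_types, lifting) inj_onI diff_diff_cancel)
  have length: "length (coweights C) = card ?W"
    using inj by (simp add: coweights_def card_image)
  have "(\<Sum>i<card ?W. coweights C ! i) = sum_list (coweights C)"
    by (simp add: sum_list_sum_nth length atLeast0LessThan)
  also have "\<dots> = \<Sum> ?S"
    using W sum_list_distinct_conv_sum_set[of "coweights C" id] by (simp add: coweights_def)
  also have "\<dots> = (\<Sum>w\<in>?W. CARD('n) - w)"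
    using inj by (simp add: sum.reindex)
  finally have coweights: "(\<Sum>i<card ?W. int (coweights C ! i)) = int (\<Sum>w\<in>?W. CARD('n) - w)"
    by (metis of_nat_sum)
  have gauss: "2 * (\<Sum>i<N. int i) = int N * (int N - 1)" for N
    by (induction N) (auto simp: algebra_simps)
  show ?thesis
    unfolding spread_def sum_subtractf coweights
    by (simp only: right_diff_distrib[of "2 :: int"] gauss)
qed

theorem theorem12:
  fixes C :: "('a::{field,finite} ^ 'n) set" and q k n :: nat
  assumes "CARD('a) = q" and "CARD('n) = n"
    and "k \<ge> 2"
    and "mws_code k C"
    and "non_degenerate C"
  shows "real n = real q / 2 * real (q_number q k)
                    + real_of_int (spread C) / real (q_number q (k - 1))"
proof -
  obtain m where k: "k = Suc (Suc m)"
    using assms(3) by (metis Suc_le_D numeral_2_eq_2 Suc_le_mono)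
  \<comment> \<open>\<open>?R\<close> is \<open>q\<^sub>k\<^sub>-\<^sub>1\<close>; it is positive because \<open>k \<ge> 2\<close>, which permits the final division.\<close>
  let ?Q = "q_number q k" and ?R = "q_number q (Suc m)"
  have q: "q \<ge> 2" using CARD_field_ge_2 assms(1) by metis
  have R: "?R > 0" using q by (simp add: q_number_Suc)
  have Q: "?Q = q * ?R + 1" using q by (simp add: k q_number_Suc)
  have "card (weight_spectrum C) = ?Q"
    using assms by (simp add: mws_code_def)
  moreover have "(\<Sum>w\<in>weight_spectrum C. CARD('n) - w) = n * ?R"
    using mws_sum_coweights[of "Suc m" C] assms k by simp
  ultimately have "2 * spread C = 2 * int (n * ?R) - int ?Q * (int ?Q - 1)"
    using twice_spread[of C] by simp
  also have "\<dots> = (2 * int n - int q * int ?Q) * int ?R"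
    using Q by (simp add: algebra_simps)
  finally have "real_of_int (2 * spread C) = real_of_int ((2 * int n - int q * int ?Q) * int ?R)"
    by (rule arg_cong)
  then have "2 * real_of_int (spread C) = (2 * real n - real q * real ?Q) * real ?R"
    by simp
  then have "real_of_int (spread C) / real ?R = (2 * real n - real q * real ?Q) / 2"
    using R by (simp add: field_simps)
  then show ?thesis by (simp add: k field_simps)
qed

end
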